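(* Let $X$ and $Y$ be real valued random variables on a probability space $(\Omega,\mathcal{F},P)$ such that $X$, $Y$ and $XY$ are all integrable. Then the following hold. (a) If $\mathrm{E}^X(Y)=\mathrm{E}(Y)$ almost surely, then $\mathrm{Cov}(X,Y)=0$, and there exist $\alpha,\beta\in\mathbb{R}$ such that $\mathrm{E}^X(Y)=\alpha+\beta X$ almost surely. (b) Conversely, if $\mathrm{E}^X(Y)=\alpha+\beta X$ almost surely for some $\alpha,\beta\in\mathbb{R}$, then $$\alpha=\mathrm{E}(Y)-\beta\,\mathrm{E}(X)\qquad\text{and}\qquad \beta=\frac{\mathrm{Cov}(X,Y)}{\mathrm{Var}(X)}\,[\mathrm{Var}(X)>0].$$ (c) Further, if $\mathrm{E}^X(Y)=\alpha+\beta X$ almost surely for some $\alpha,\beta\in\mathbb{R}$, then the identity $\beta=\frac{\mathrm{Cov}(X,Y)}{\mathrm{Var}(X)}[\mathrm{Var}(X)>0]$ in conjunction with $\mathrm{Cov}(X,Y)=0$ implies that $\mathrm{E}^X(Y)=\mathrm{E}(Y)$ almost surely.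
   Context: $\mathrm{E}$ denotes expectation with respect to $P$, and $\mathrm{E}^X(Y)$ denotes the conditional expectation of $Y$ given the $\sigma$-algebra $\sigma(X)$ generated by $X$. $\mathrm{Cov}(X,Y)=\mathrm{E}(XY)-\mathrm{E}(X)\mathrm{E}(Y)$, which is well defined when $X$, $Y$ and $XY$ are integrable; no finite second moment is assumed for $X$ or $Y$. $\mathrm{Var}(X)=\mathrm{E}\big((X-\mathrm{E}(X))^2\big)\in[0,\infty]$ is well defined for integrable $X$, possibly equal to $\infty$. The bracket $[\,\cdot\,]$ is the indicator (equal to $1$ if the condition inside holds, $0$ otherwise). The expression $\frac{\mathrm{Cov}(X,Y)}{\mathrm{Var}(X)}[\mathrm{Var}(X)>0]$ is understood to be $0$ when $\mathrm{Var}(X)=0$ and also $0$ when $\mathrm{Var}(X)=\infty$.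
   Formalization: In (b) the formula for β is asserted only when Var(X)>0, since for a.s. constant X (e.g. X=Y=0, α=0, β=7) it fails; in every case it is shown instead that some α, β given by both formulas satisfy E^X(Y)=α+βX a.s. *)

theory Defs
  imports "HOL-Probability.Probability"
begin

definition cond_exp_given :: "'a measure \<Rightarrow> ('a \<Rightarrow> real) \<Rightarrow> ('a \<Rightarrow> real) \<Rightarrow> 'a \<Rightarrow> real" where
  "cond_exp_given M X Y = real_cond_exp M (vimage_algebra (space M) X borel) Y"

definition Cov :: "'a measure \<Rightarrow> ('a \<Rightarrow> real) \<Rightarrow> ('a \<Rightarrow> real) \<Rightarrow> real" where
  "Cov M X Y = (\<integral>\<omega>. X \<omega> * Y \<omega> \<partial>M) - (\<integral>\<omega>. X \<omega> \<partial>M) * (\<integral>\<omega>. Y \<omega> \<partial>M)"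

text \<open>The library's \<open>variance\<close> is a Bochner integral, hence \<open>0\<close> when the second moment is
  infinite. Here an infinite variance must be distinguished from a vanishing one, so the
  variance takes values in \<open>[0, \<infinity>]\<close>.\<close>

definition Var :: "'a measure \<Rightarrow> ('a \<Rightarrow> real) \<Rightarrow> ennreal" where
  "Var M X = (\<integral>\<^sup>+\<omega>. ennreal ((X \<omega> - (\<integral>\<omega>'. X \<omega>' \<partial>M))\<^sup>2) \<partial>M)"

text \<open>The quotient \<open>Cov(X,Y) / Var(X) [Var(X) > 0]\<close>, read as \<open>0\<close> if \<open>Var(X)\<close> is \<open>0\<close>
  or \<open>\<infinity>\<close>. If \<open>Var(X) = 0\<close>, then \<open>X\<close> is almost surely constant and a representation
  \<open>\<alpha> + \<beta> X\<close> of the conditional expectation does not determine \<open>\<beta>\<close>; the value \<open>0\<close> is then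
  one admissible choice.\<close>

definition reg_coeff :: "'a measure \<Rightarrow> ('a \<Rightarrow> real) \<Rightarrow> ('a \<Rightarrow> real) \<Rightarrow> real" where
  "reg_coeff M X Y =
     (if 0 < Var M X \<and> Var M X < \<infinity> then Cov M X Y / enn2real (Var M X) else 0)"

end

theory Submission
  imports Defs
begin

text \<open>
  Everything rests on testing the conditional expectation against \<open>X\<close> itself. Since \<open>X\<close> is
  \<open>\<sigma>(X)\<close>-measurable and \<open>X Y\<close> is integrable, \<open>X \<cdot> E\<^sup>X(Y)\<close> is integrable with expectation
  \<open>E(X Y)\<close>. If \<open>E\<^sup>X(Y) = \<alpha> + \<beta> X\<close>, taking expectations gives \<open>\<alpha> = E(Y) - \<beta> E(X)\<close>, while
  testing against \<open>X\<close> makes \<open>\<alpha> X + \<beta> X\<^sup>2\<close> integrable. Hence either \<open>\<beta> = 0\<close>, or \<open>X\<close> has a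
  finite second moment although none was assumed
  (\<open>finite_Var_of_linear_cond_exp\<close>). This is exactly why an infinite variance forces the slope
  \<open>0\<close>. When the variance is finite, the two moment equations combine to
  \<open>Cov(X,Y) = \<beta> Var(X)\<close> (\<open>Cov_eq_slope_mult_Var\<close>), which determines \<open>\<beta>\<close> if the variance is
  positive. When the variance vanishes, \<open>X\<close> is almost surely constant, so that the same
  conditional expectation is also represented by slope \<open>0\<close> and intercept \<open>E(Y)\<close>.
\<close>

lemma (in prob_space) sigma_finite_subalgebra_generated:
  assumes "X \<in> borel_measurable M"
  shows "sigma_finite_subalgebra M (vimage_algebra (space M) X borel)"
proof -
  have "subalgebra M (vimage_algebra (space M) X borel)"
    using assms by (simp add: subalgebra_def measurable_iff_sets)
  then interpret finite_measure_subalgebra M "vimage_algebra (space M) X borel"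
    by unfold_locales
  show ?thesis ..
qed

lemma borel_measurable_generator:
  "X \<in> borel_measurable (vimage_algebra (space M) X borel)"
  by (rule measurable_vimage_algebra1) auto

lemma (in prob_space)
  assumes "integrable M X" and "integrable M Y"
  shows integrable_cond_exp_given: "integrable M (cond_exp_given M X Y)"
    and expectation_cond_exp_given: "expectation (cond_exp_given M X Y) = expectation Y"
proof -
  interpret G: sigma_finite_subalgebra M "vimage_algebra (space M) X borel"
    using assms(1) by (intro sigma_finite_subalgebra_generated) auto
  show "integrable M (cond_exp_given M X Y)"
    and "expectation (cond_exp_given M X Y) = expectation Y"
    unfolding cond_exp_given_def using G.real_cond_exp_int[OF assms(2)] by simp_all
qed

text \<open>
  The projection property of conditional expectation, with the unbounded test function \<open>X\<close>; the
  integrability of \<open>X Y\<close> replaces the usual boundedness of the test function.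
\<close>

lemma (in prob_space)
  assumes "integrable M X" and "integrable M (\<lambda>\<omega>. X \<omega> * Y \<omega>)" and "integrable M Y"
  shows integrable_mult_cond_exp_given: "integrable M (\<lambda>\<omega>. X \<omega> * cond_exp_given M X Y \<omega>)"
    and expectation_mult_cond_exp_given:
      "expectation (\<lambda>\<omega>. X \<omega> * cond_exp_given M X Y \<omega>) = expectation (\<lambda>\<omega>. X \<omega> * Y \<omega>)"
proof -
  interpret G: sigma_finite_subalgebra M "vimage_algebra (space M) X borel"
    using assms(1) by (intro sigma_finite_subalgebra_generated) auto
  have "Y \<in> borel_measurable M" using assms(3) by auto
  note * = G.real_cond_exp_intg[OF assms(2) borel_measurable_generator this]
  show "integrable M (\<lambda>\<omega>. X \<omega> * cond_exp_given M X Y \<omega>)"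
    and "expectation (\<lambda>\<omega>. X \<omega> * cond_exp_given M X Y \<omega>) = expectation (\<lambda>\<omega>. X \<omega> * Y \<omega>)"
    unfolding cond_exp_given_def using * by simp_all
qed

lemma (in prob_space) intercept_eq:
  assumes "integrable M X" and "integrable M Y"
    and "AE \<omega> in M. cond_exp_given M X Y \<omega> = \<alpha> + \<beta> * X \<omega>"
  shows "\<alpha> = expectation Y - \<beta> * expectation X"
proof -
  have "expectation Y = expectation (cond_exp_given M X Y)"
    using expectation_cond_exp_given[OF assms(1,2)] by simp
  also have "\<dots> = expectation (\<lambda>\<omega>. \<alpha> + \<beta> * X \<omega>)"
    using assms integrable_cond_exp_given[OF assms(1,2)]
    by (intro integral_cong_AE) auto
  also have "\<dots> = \<alpha> + \<beta> * expectation X"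
    using assms(1) by (simp add: prob_space)
  finally show ?thesis by simp
qed

lemma (in prob_space)
  assumes "integrable M X" and "integrable M Y" and "integrable M (\<lambda>\<omega>. X \<omega> * Y \<omega>)"
    and "AE \<omega> in M. cond_exp_given M X Y \<omega> = \<alpha> + \<beta> * X \<omega>"
  shows integrable_mult_linear: "integrable M (\<lambda>\<omega>. X \<omega> * (\<alpha> + \<beta> * X \<omega>))"
    and expectation_mult_linear:
      "expectation (\<lambda>\<omega>. X \<omega> * (\<alpha> + \<beta> * X \<omega>)) = expectation (\<lambda>\<omega>. X \<omega> * Y \<omega>)"
proof -
  have XE: "integrable M (\<lambda>\<omega>. X \<omega> * cond_exp_given M X Y \<omega>)"
    by (rule integrable_mult_cond_exp_given[OF assms(1,3,2)])
  have eq: "AE \<omega> in M. X \<omega> * cond_exp_given M X Y \<omega> = X \<omega> * (\<alpha> + \<beta> * X \<omega>)"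
    using assms(4) by auto
  have meas: "(\<lambda>\<omega>. X \<omega> * (\<alpha> + \<beta> * X \<omega>)) \<in> borel_measurable M"
    using assms(1) by auto
  show "integrable M (\<lambda>\<omega>. X \<omega> * (\<alpha> + \<beta> * X \<omega>))"
    by (rule Bochner_Integration.integrable_cong_AE_imp[OF XE meas eq])
  show "expectation (\<lambda>\<omega>. X \<omega> * (\<alpha> + \<beta> * X \<omega>)) = expectation (\<lambda>\<omega>. X \<omega> * Y \<omega>)"
    using integral_cong_AE[OF borel_measurable_integrable[OF XE] meas eq]
      expectation_mult_cond_exp_given[OF assms(1,3,2)] by simp
qed

text \<open>
  With a nonzero slope, \<open>X\<^sup>2\<close> is a linear combination of the integrable functions \<open>X\<close> and
  \<open>X (\<alpha> + \<beta> X)\<close>.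
\<close>

lemma (in prob_space) square_integrable_of_linear_cond_exp:
  assumes "integrable M X" and "integrable M Y" and "integrable M (\<lambda>\<omega>. X \<omega> * Y \<omega>)"
    and "AE \<omega> in M. cond_exp_given M X Y \<omega> = \<alpha> + \<beta> * X \<omega>" and "\<beta> \<noteq> 0"
  shows "integrable M (\<lambda>\<omega>. (X \<omega>)\<^sup>2)"
proof -
  have "integrable M (\<lambda>\<omega>. (X \<omega> * (\<alpha> + \<beta> * X \<omega>) - \<alpha> * X \<omega>) / \<beta>)"
    using integrable_mult_linear[OF assms(1-4)] assms(1) by auto
  also have "(\<lambda>\<omega>. (X \<omega> * (\<alpha> + \<beta> * X \<omega>) - \<alpha> * X \<omega>) / \<beta>) = (\<lambda>\<omega>. (X \<omega>)\<^sup>2)"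
    using \<open>\<beta> \<noteq> 0\<close> by (auto simp: field_simps power2_eq_square)
  finally show ?thesis .
qed

lemma (in prob_space) Var_eq_variance:
  assumes "integrable M X" and "integrable M (\<lambda>\<omega>. (X \<omega>)\<^sup>2)"
  shows "Var M X = ennreal (variance X)"
proof -
  have "integrable M (\<lambda>\<omega>. (X \<omega> - expectation X)\<^sup>2)"
    using assms by (simp add: power2_diff)
  then show ?thesis
    unfolding Var_def by (intro nn_integral_eq_integral) auto
qed

lemma (in prob_space) square_integrable_of_finite_Var:
  assumes "integrable M X" and "Var M X < \<infinity>"
  shows "integrable M (\<lambda>\<omega>. (X \<omega>)\<^sup>2)"
proof -
  have "integrable M (\<lambda>\<omega>. (X \<omega> - expectation X)\<^sup>2)"
    using assms unfolding Var_def by (intro integrableI_nonneg) auto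
  then have "integrable M (\<lambda>\<omega>. (X \<omega> - expectation X)\<^sup>2 + 2 * expectation X * X \<omega> - (expectation X)\<^sup>2)"
    using assms(1) by auto
  then show ?thesis by (simp add: power2_diff algebra_simps)
qed

lemma (in prob_space) finite_Var_of_linear_cond_exp:
  assumes "integrable M X" and "integrable M Y" and "integrable M (\<lambda>\<omega>. X \<omega> * Y \<omega>)"
    and "AE \<omega> in M. cond_exp_given M X Y \<omega> = \<alpha> + \<beta> * X \<omega>" and "\<beta> \<noteq> 0"
  shows "Var M X < \<infinity>"
  using Var_eq_variance[OF assms(1) square_integrable_of_linear_cond_exp[OF assms]] by simp

text \<open>
  Multiplying the intercept equation by \<open>E(X)\<close> and subtracting it from
  \<open>E(X Y) = \<alpha> E(X) + \<beta> E(X\<^sup>2)\<close> leaves \<open>\<beta>\<close> times the variance.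
\<close>

lemma (in prob_space) Cov_eq_slope_mult_Var:
  assumes "integrable M X" and "integrable M Y" and "integrable M (\<lambda>\<omega>. X \<omega> * Y \<omega>)"
    and "AE \<omega> in M. cond_exp_given M X Y \<omega> = \<alpha> + \<beta> * X \<omega>" and "Var M X < \<infinity>"
  shows "Cov M X Y = \<beta> * enn2real (Var M X)"
proof -
  note sq = square_integrable_of_finite_Var[OF assms(1,5)]
  have "expectation (\<lambda>\<omega>. X \<omega> * Y \<omega>) = expectation (\<lambda>\<omega>. \<alpha> * X \<omega> + \<beta> * (X \<omega>)\<^sup>2)"
    using expectation_mult_linear[OF assms(1-4)] by (simp add: algebra_simps power2_eq_square)
  also have "\<dots> = \<alpha> * expectation X + \<beta> * expectation (\<lambda>\<omega>. (X \<omega>)\<^sup>2)"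
    using assms(1) sq by simp
  finally have XY: "expectation (\<lambda>\<omega>. X \<omega> * Y \<omega>) = \<dots>" .
  have V: "enn2real (Var M X) = expectation (\<lambda>\<omega>. (X \<omega>)\<^sup>2) - (expectation X)\<^sup>2"
    using Var_eq_variance[OF assms(1) sq] variance_eq[OF assms(1) sq] variance_positive[of X] by simp
  have EY: "expectation Y = \<alpha> + \<beta> * expectation X"
    using intercept_eq[OF assms(1,2,4)] by simp
  show ?thesis
    unfolding Cov_def XY EY V by (simp add: algebra_simps power2_eq_square)
qed

lemma (in prob_space) AE_eq_expectation_of_Var_eq_0:
  assumes "integrable M X" and "Var M X = 0"
  shows "AE \<omega> in M. X \<omega> = expectation X"
proof -
  have "AE \<omega> in M. ennreal ((X \<omega> - expectation X)\<^sup>2) = 0"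
    using assms unfolding Var_def by (subst (asm) nn_integral_0_iff_AE) auto
  then show ?thesis by eventually_elim simp
qed

text \<open>
  Positive variance is essential: if \<open>X\<close> is almost surely constant, then every real number
  occurs as a slope. For finite variance the formula comes from
  \<open>Cov_eq_slope_mult_Var\<close>; for infinite variance both sides are \<open>0\<close>, because a nonzero slope
  would make the variance finite.
\<close>

lemma (in prob_space) slope_eq_reg_coeff:
  assumes "integrable M X" and "integrable M Y" and "integrable M (\<lambda>\<omega>. X \<omega> * Y \<omega>)"
    and "AE \<omega> in M. cond_exp_given M X Y \<omega> = \<alpha> + \<beta> * X \<omega>" and "0 < Var M X"
  shows "\<beta> = reg_coeff M X Y"
proof (cases "Var M X < \<infinity>")
  case True
  then have "0 < enn2real (Var M X)"
    using assms(5) by (simp add: enn2real_positive_iff)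
  then show ?thesis
    using Cov_eq_slope_mult_Var[OF assms(1-4) True] True assms(5) by (simp add: reg_coeff_def)
next
  case False
  then show ?thesis
    using finite_Var_of_linear_cond_exp[OF assms(1-4)] by (auto simp: reg_coeff_def)
qed

text \<open>
  The regression line always represents a conditional expectation that is linear at all. It
  can differ from the given line only if \<open>X\<close> is almost surely constant, and then both lines
  pass through the one point \<open>(E(X), E(Y))\<close> that matters.
\<close>

lemma (in prob_space) linear_cond_exp_reg_coeff:
  assumes "integrable M X" and "integrable M Y" and "integrable M (\<lambda>\<omega>. X \<omega> * Y \<omega>)"
    and lin: "AE \<omega> in M. cond_exp_given M X Y \<omega> = \<alpha> + \<beta> * X \<omega>"
  shows "AE \<omega> in M. cond_exp_given M X Y \<omega> =
    (expectation Y - reg_coeff M X Y * expectation X) + reg_coeff M X Y * X \<omega>"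
proof (cases "Var M X = 0")
  case True
  have "AE \<omega> in M. cond_exp_given M X Y \<omega> = expectation Y"
    using lin AE_eq_expectation_of_Var_eq_0[OF assms(1) True]
    by eventually_elim (simp add: intercept_eq[OF assms(1,2) lin])
  with True show ?thesis by (simp add: reg_coeff_def)
next
  case False
  then have "\<beta> = reg_coeff M X Y"
    using slope_eq_reg_coeff[OF assms] by (simp add: zero_less_iff_neq_zero)
  then show ?thesis
    using lin intercept_eq[OF assms(1,2) lin] by simp
qed

lemma (in prob_space) Cov_eq_0_of_constant_cond_exp:
  assumes "integrable M X" and "integrable M Y" and "integrable M (\<lambda>\<omega>. X \<omega> * Y \<omega>)"
    and "AE \<omega> in M. cond_exp_given M X Y \<omega> = expectation Y"
  shows "Cov M X Y = 0"
proof -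
  have "AE \<omega> in M. cond_exp_given M X Y \<omega> = expectation Y + 0 * X \<omega>"
    using assms(4) by simp
  from expectation_mult_linear[OF assms(1-3) this] show ?thesis
    by (simp add: Cov_def)
qed

theorem theorem1:
  fixes M :: "'a measure" and X Y :: "'a \<Rightarrow> real"
  assumes "prob_space M"
    and "integrable M X" and "integrable M Y" and "integrable M (\<lambda>\<omega>. X \<omega> * Y \<omega>)"
  shows
    "((AE \<omega> in M. cond_exp_given M X Y \<omega> = integral\<^sup>L M Y) \<longrightarrow>
       Cov M X Y = 0 \<and>
       (\<exists>\<alpha> \<beta> :: real. AE \<omega> in M. cond_exp_given M X Y \<omega> = \<alpha> + \<beta> * X \<omega>))
     \<and>
     (\<forall>\<alpha> \<beta> :: real. (AE \<omega> in M. cond_exp_given M X Y \<omega> = \<alpha> + \<beta> * X \<omega>) \<longrightarrow>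
       \<alpha> = integral\<^sup>L M Y - \<beta> * integral\<^sup>L M X \<and>
       (0 < Var M X \<longrightarrow> \<beta> = reg_coeff M X Y) \<and>
       (\<exists>\<alpha>' \<beta>' :: real. (AE \<omega> in M. cond_exp_given M X Y \<omega> = \<alpha>' + \<beta>' * X \<omega>) \<and>
          \<alpha>' = integral\<^sup>L M Y - \<beta>' * integral\<^sup>L M X \<and> \<beta>' = reg_coeff M X Y))
     \<and>
     (\<forall>\<alpha> \<beta> :: real. (AE \<omega> in M. cond_exp_given M X Y \<omega> = \<alpha> + \<beta> * X \<omega>) \<longrightarrow>
       \<beta> = reg_coeff M X Y \<and> Cov M X Y = 0 \<longrightarrow>
       (AE \<omega> in M. cond_exp_given M X Y \<omega> = integral\<^sup>L M Y))"
proof -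
  interpret prob_space M by fact
  note int = assms(2-4)
  show ?thesis
  proof (intro conjI allI impI)
    assume const: "AE \<omega> in M. cond_exp_given M X Y \<omega> = integral\<^sup>L M Y"
    then show "Cov M X Y = 0"
      by (rule Cov_eq_0_of_constant_cond_exp[OF int])
    from const show "\<exists>\<alpha> \<beta>. AE \<omega> in M. cond_exp_given M X Y \<omega> = \<alpha> + \<beta> * X \<omega>"
      by (intro exI[of _ "integral\<^sup>L M Y"] exI[of _ 0]) simp
  next
    fix \<alpha> \<beta> :: real
    assume lin: "AE \<omega> in M. cond_exp_given M X Y \<omega> = \<alpha> + \<beta> * X \<omega>"
    show "\<alpha> = integral\<^sup>L M Y - \<beta> * integral\<^sup>L M X"
      by (rule intercept_eq[OF int(1,2) lin])
    show "\<beta> = reg_coeff M X Y" if "0 < Var M X"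
      by (rule slope_eq_reg_coeff[OF int lin that])
    show "\<exists>\<alpha>' \<beta>'. (AE \<omega> in M. cond_exp_given M X Y \<omega> = \<alpha>' + \<beta>' * X \<omega>) \<and>
        \<alpha>' = integral\<^sup>L M Y - \<beta>' * integral\<^sup>L M X \<and> \<beta>' = reg_coeff M X Y"
      using linear_cond_exp_reg_coeff[OF int lin] by blast
  next
    fix \<alpha> \<beta> :: real
    assume lin: "AE \<omega> in M. cond_exp_given M X Y \<omega> = \<alpha> + \<beta> * X \<omega>"
    assume "\<beta> = reg_coeff M X Y \<and> Cov M X Y = 0"
    then have "reg_coeff M X Y = 0"
      by (simp add: reg_coeff_def)
    then show "AE \<omega> in M. cond_exp_given M X Y \<omega> = integral\<^sup>L M Y"
      using linear_cond_exp_reg_coeff[OF int lin] by simp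
  qed
qed

end
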